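(* Let $\mathcal{A}$ be a Banach algebra and let $\sigma\in Hom(\mathcal{A})$. If $\mathcal{A}$ has a $\sigma$-virtual diagonal, then $\mathcal{A}$ is $\sigma$-biflat.
   Context: $Hom(\mathcal{A})$ is the set of all continuous algebra homomorphisms $\mathcal{A}\to\mathcal{A}$. The projective tensor product $\mathcal{A}\widehat{\otimes}\mathcal{A}$ is a Banach $\mathcal{A}$-bimodule via $a\cdot(b\otimes c)=ab\otimes c$ and $(b\otimes c)\cdot a=b\otimes ca$. The diagonal operator is $\pi:\mathcal{A}\widehat{\otimes}\mathcal{A}\to\mathcal{A}$, $\pi(a\otimes b)=ab$. For a Banach $\mathcal{A}$-bimodule $X$, the dual $X^*$ is a Banach $\mathcal{A}$-bimodule via $\langle a\cdot\lambda,x\rangle=\langle\lambda,x\cdot a\rangle$ and $\langle\lambda\cdot a,x\rangle=\langle\lambda,a\cdot x\rangle$; biduals are bimodules by iterating this. An element $M\in(\mathcal{A}\widehat{\otimes}\mathcal{A})^{**}$ is a $\sigma$-virtual diagonal for $\mathcal{A}$ if $\sigma(a)\cdot M=M\cdot\sigma(a)$ and $\pi^{**}(M)\cdot\sigma(a)=\sigma(a)$ for all $a\in\mathcal{A}$, where $\mathcal{A}$ is identified with its canonical image in $\mathcal{A}^{**}$. $\mathcal{A}$ is $\sigma$-biflat if there exists a bounded linear map $\rho:(\mathcal{A}\widehat{\otimes}\mathcal{A})^*\to\mathcal{A}^*$ such that $\rho(\sigma(a)\cdot\lambda)=a\cdot\rho(\lambda)$ and $\rho(\lambda\cdot\sigma(a))=\rho(\lambda)\cdot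 a$ for all $a\in\mathcal{A}$, $\lambda\in(\mathcal{A}\widehat{\otimes}\mathcal{A})^*$, and $\rho\circ\pi^*=\sigma^*$. *)

theory Defs
  imports "HOL-Analysis.Analysis" "HOL-Library.Multiset"
begin

section \<open>Complex normed spaces and complex Banach algebras\<close>

text \<open>
  The distribution only has real normed spaces as type classes. Complex scalars are added on top of
  them. A complex Banach space has sort \<open>{complex_normed_vector, banach}\<close>, a complex Banach algebra
  (not necessarily unital, with submultiplicative norm) has sort \<open>{complex_normed_algebra, banach}\<close>.
\<close>

class scaleC =
  fixes scaleC :: "complex \<Rightarrow> 'a \<Rightarrow> 'a"  (infixr "*\<^sub>C" 75)

class complex_vector = real_vector + scaleC +
  assumes scaleC_add_right: "c *\<^sub>C (x + y) = c *\<^sub>C x + c *\<^sub>C y"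
    and scaleC_add_left: "(c + d) *\<^sub>C x = c *\<^sub>C x + d *\<^sub>C x"
    and scaleC_scaleC: "c *\<^sub>C d *\<^sub>C x = (c * d) *\<^sub>C x"
    and scaleC_of_real: "complex_of_real r *\<^sub>C x = r *\<^sub>R x"

lemma scaleC_one [simp]: "1 *\<^sub>C x = x" for x :: "'a::complex_vector"
  using scaleC_of_real[of 1 x] by simp

lemma scaleC_zero_left [simp]: "0 *\<^sub>C x = 0" for x :: "'a::complex_vector"
  using scaleC_of_real[of 0 x] by simp

lemma scaleC_zero_right [simp]: "c *\<^sub>C 0 = (0 :: 'a::complex_vector)"
  using scaleC_add_right[of c "0::'a" 0] by simp

class complex_normed_vector = complex_vector + real_normed_vector +
  assumes norm_scaleC: "norm (c *\<^sub>C x) = cmod c * norm x"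

class complex_normed_algebra = complex_normed_vector + real_normed_algebra +
  assumes mult_scaleC_left: "(c *\<^sub>C x) * y = c *\<^sub>C (x * y)"
    and mult_scaleC_right: "x * (c *\<^sub>C y) = c *\<^sub>C (x * y)"

instantiation complex :: complex_normed_algebra
begin

definition scaleC_complex :: "complex \<Rightarrow> complex \<Rightarrow> complex"
  where [simp]: "scaleC_complex c x = c * x"

instance
  by standard (simp_all add: algebra_simps norm_mult scaleR_conv_of_real)

end

definition bounded_clinear :: "('a::complex_normed_vector \<Rightarrow> 'b::complex_normed_vector) \<Rightarrow> bool"
  where "bounded_clinear f \<longleftrightarrow> bounded_linear f \<and> (\<forall>c x. f (c *\<^sub>C x) = c *\<^sub>C f x)"

definition bounded_cbilinear ::
    "('a::complex_normed_vector \<Rightarrow> 'b::complex_normed_vector \<Rightarrow> 'c::complex_normed_vector) \<Rightarrow> bool"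
  where "bounded_cbilinear f \<longleftrightarrow> bounded_bilinear f \<and>
    (\<forall>c x y. f (c *\<^sub>C x) y = c *\<^sub>C f x y) \<and> (\<forall>c x y. f x (c *\<^sub>C y) = c *\<^sub>C f x y)"

lemma bounded_clinear_compose:
  "bounded_clinear f \<Longrightarrow> bounded_clinear g \<Longrightarrow> bounded_clinear (\<lambda>x. f (g x))"
  by (auto simp: bounded_clinear_def bounded_linear_compose)


section \<open>The dual space\<close>

typedef (overloaded) 'a cdual =
  "{f :: 'a::complex_normed_vector \<Rightarrow>\<^sub>L complex. \<forall>c x. blinfun_apply f (c *\<^sub>C x) = c * blinfun_apply f x}"
  by (rule exI[of _ 0]) simp

setup_lifting type_definition_cdual

lift_definition cdual_apply :: "'a::complex_normed_vector cdual \<Rightarrow> 'a \<Rightarrow> complex"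
  is blinfun_apply .

lemma cdual_eqI: "(\<And>x. cdual_apply \<phi> x = cdual_apply \<psi> x) \<Longrightarrow> \<phi> = \<psi>"
  by transfer (simp add: blinfun_eqI)

lemma bounded_clinear_cdual_apply: "bounded_clinear (cdual_apply \<phi>)"
  unfolding bounded_clinear_def by transfer (auto intro: blinfun.bounded_linear_right)

instantiation cdual :: (complex_normed_vector) complex_normed_vector
begin

lift_definition zero_cdual :: "'a cdual" is 0 by simp
lift_definition plus_cdual :: "'a cdual \<Rightarrow> 'a cdual \<Rightarrow> 'a cdual" is "(+)"
  by (simp add: blinfun.add_left algebra_simps)
lift_definition minus_cdual :: "'a cdual \<Rightarrow> 'a cdual \<Rightarrow> 'a cdual" is "(-)"
  by (simp add: blinfun.diff_left algebra_simps)
lift_definition uminus_cdual :: "'a cdual \<Rightarrow> 'a cdual" is uminus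
  by (simp add: blinfun.minus_left)
lift_definition scaleR_cdual :: "real \<Rightarrow> 'a cdual \<Rightarrow> 'a cdual" is scaleR
  by (simp add: blinfun.scaleR_left)
lift_definition scaleC_cdual :: "complex \<Rightarrow> 'a cdual \<Rightarrow> 'a cdual"
  is "\<lambda>c f. Blinfun (\<lambda>x. c * blinfun_apply f x)"
  by (simp add: bounded_linear_Blinfun_apply bounded_linear_const_mult
      blinfun.bounded_linear_right)
lift_definition norm_cdual :: "'a cdual \<Rightarrow> real" is norm .

definition dist_cdual :: "'a cdual \<Rightarrow> 'a cdual \<Rightarrow> real"
  where "dist_cdual f g = norm (f - g)"
definition sgn_cdual :: "'a cdual \<Rightarrow> 'a cdual"
  where "sgn_cdual f = inverse (norm f) *\<^sub>R f"
definition uniformity_cdual :: "('a cdual \<times> 'a cdual) filter"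
  where "uniformity_cdual = (INF e\<in>{0<..}. principal {(f, g). dist f g < e})"
definition open_cdual :: "'a cdual set \<Rightarrow> bool"
  where "open_cdual U \<longleftrightarrow> (\<forall>x\<in>U. \<forall>\<^sub>F (x', y) in uniformity. x' = x \<longrightarrow> y \<in> U)"

instance
proof
  fix f g h :: "'a cdual" and r s :: real and c d :: complex
  have ap: "cdual_apply (c *\<^sub>C F) x = c * cdual_apply F x" for c and F :: "'a cdual" and x
    by transfer (simp add: bounded_linear_Blinfun_apply bounded_linear_const_mult
      blinfun.bounded_linear_right)
  have add: "cdual_apply (F + G) x = cdual_apply F x + cdual_apply G x" for F G :: "'a cdual" and x
    by transfer (simp add: blinfun.add_left)
  have scaleR: "cdual_apply (r *\<^sub>R F) x = of_real r * cdual_apply F x" for r and F :: "'a cdual" and x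
    by transfer (simp add: blinfun.scaleR_left scaleR_conv_of_real)
  show "f + g + h = f + (g + h)" "f + g = g + f" "0 + f = f" "- f + f = 0" "f - g = f + - g"
    by (transfer, simp add: algebra_simps)+
  show "r *\<^sub>R (f + g) = r *\<^sub>R f + r *\<^sub>R g" "(r + s) *\<^sub>R f = r *\<^sub>R f + s *\<^sub>R f"
    "r *\<^sub>R s *\<^sub>R f = (r * s) *\<^sub>R f" "1 *\<^sub>R f = f"
    by (transfer, simp add: algebra_simps)+
  show "c *\<^sub>C (f + g) = c *\<^sub>C f + c *\<^sub>C g" "(c + d) *\<^sub>C f = c *\<^sub>C f + d *\<^sub>C f"
    "c *\<^sub>C d *\<^sub>C f = (c * d) *\<^sub>C f" "complex_of_real r *\<^sub>C f = r *\<^sub>R f"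
    by (rule cdual_eqI, simp add: ap add scaleR distrib_left distrib_right)+
  show norm0: "(norm f = 0) = (f = 0)" and "norm (f + g) \<le> norm f + norm g"
    "norm (r *\<^sub>R f) = \<bar>r\<bar> * norm f"
    by (transfer, simp add: norm_triangle_ineq)+
  have bnd: "cmod (cdual_apply F x) \<le> norm F * norm x" for F :: "'a cdual" and x
    by transfer (rule norm_blinfun)
  have nonneg: "0 \<le> norm F" for F :: "'a cdual"
    by transfer simp
  have le: "norm (c *\<^sub>C F) \<le> cmod c * norm F" for c and F :: "'a cdual"
  proof -
    have "norm F \<le> b" if "0 \<le> b" "\<And>x. cmod (cdual_apply F x) \<le> b * norm x" for b and F :: "'a cdual"
      using that by transfer (rule norm_blinfun_bound)
    moreover have "cmod (cdual_apply (c *\<^sub>C F) x) \<le> cmod c * norm F * norm x" for x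
      using mult_left_mono[OF bnd[of F x], of "cmod c"] by (simp add: ap norm_mult mult.assoc)
    ultimately show ?thesis by (simp add: nonneg)
  qed
  have smul: "c *\<^sub>C d *\<^sub>C F = (c * d) *\<^sub>C F" "1 *\<^sub>C F = F" for c d and F :: "'a cdual"
    by (rule cdual_eqI, simp add: ap)+
  show "norm (c *\<^sub>C f) = cmod c * norm f"
  proof (cases "c = 0")
    case True
    then show ?thesis using le[of 0 f] nonneg[of "0 *\<^sub>C f"] by simp
  next
    case False
    have "norm f = norm (inverse c *\<^sub>C c *\<^sub>C f)" using False by (simp add: smul)
    also have "\<dots> \<le> inverse (cmod c) * norm (c *\<^sub>C f)"
      using le[of "inverse c" "c *\<^sub>C f"] by (simp add: norm_inverse)
    finally show ?thesis using False le[of c f] by (simp add: field_simps)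
  qed
qed (simp_all add: dist_cdual_def sgn_cdual_def uniformity_cdual_def open_cdual_def)

end

lemma cdual_apply_linear [simp]:
  "cdual_apply 0 x = 0"
  "cdual_apply (\<phi> + \<psi>) x = cdual_apply \<phi> x + cdual_apply \<psi> x"
  "cdual_apply (\<phi> - \<psi>) x = cdual_apply \<phi> x - cdual_apply \<psi> x"
  "cdual_apply (- \<phi>) x = - cdual_apply \<phi> x"
  "cdual_apply (r *\<^sub>R \<phi>) x = r *\<^sub>R cdual_apply \<phi> x"
  by (transfer, simp add: blinfun.add_left blinfun.diff_left blinfun.minus_left
      blinfun.scaleR_left)+

lemma cdual_apply_scaleC [simp]: "cdual_apply (c *\<^sub>C \<phi>) x = c * cdual_apply \<phi> x"
  by transfer (simp add: bounded_linear_Blinfun_apply bounded_linear_const_mult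
      blinfun.bounded_linear_right)

lemma norm_cdual_apply: "cmod (cdual_apply \<phi> x) \<le> norm \<phi> * norm x"
  by transfer (rule norm_blinfun)

lemma norm_cdual_bound:
  "0 \<le> b \<Longrightarrow> (\<And>x. cmod (cdual_apply \<phi> x) \<le> b * norm x) \<Longrightarrow> norm \<phi> \<le> b"
  by transfer (rule norm_blinfun_bound)

instance cdual :: (complex_normed_vector) banach
proof
  fix X :: "nat \<Rightarrow> 'a cdual" assume X: "Cauchy X"
  have iso: "norm (Rep_cdual f - Rep_cdual g) = norm (f - g)" for f g :: "'a cdual"
    by (simp add: norm_cdual.rep_eq minus_cdual.rep_eq)
  have "Cauchy (\<lambda>n. Rep_cdual (X n))"
    using X by (simp add: Cauchy_def dist_norm iso)
  then obtain F where F: "(\<lambda>n. Rep_cdual (X n)) \<longlonglongrightarrow> F"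
    using Cauchy_convergent_iff convergent_def by blast
  have lim: "(\<lambda>n. blinfun_apply (Rep_cdual (X n)) x) \<longlonglongrightarrow> blinfun_apply F x" for x
    using F by (rule blinfun.tendsto) simp
  have "blinfun_apply F (c *\<^sub>C x) = c * blinfun_apply F x" for c x
  proof (rule LIMSEQ_unique[OF lim])
    have "blinfun_apply (Rep_cdual (X n)) (c *\<^sub>C x) = c * blinfun_apply (Rep_cdual (X n)) x" for n
      using Rep_cdual by blast
    then show "(\<lambda>n. blinfun_apply (Rep_cdual (X n)) (c *\<^sub>C x)) \<longlonglongrightarrow> c * blinfun_apply F x"
      by (simp add: tendsto_mult_left lim)
  qed
  then have "F = Rep_cdual (Abs_cdual F)" by (simp add: Abs_cdual_inverse)
  then have "X \<longlonglongrightarrow> Abs_cdual F"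
    using F by (metis (no_types, lifting) LIMSEQ_iff iso)
  then show "convergent X" by (auto simp: convergent_def)
qed

text \<open>For a bounded linear map \<open>T\<close>, \<open>cadjoint T\<close> is the Banach space adjoint \<open>T\<^sup>*\<close>.\<close>

definition cadjoint ::
    "('a::complex_normed_vector \<Rightarrow> 'b::complex_normed_vector) \<Rightarrow> 'b cdual \<Rightarrow> 'a cdual"
  where "cadjoint T \<phi> = Abs_cdual (Blinfun (\<lambda>x. cdual_apply \<phi> (T x)))"

lemma cdual_apply_cadjoint:
  assumes "bounded_clinear T"
  shows "cdual_apply (cadjoint T \<phi>) x = cdual_apply \<phi> (T x)"
proof -
  have b: "bounded_linear (\<lambda>x. cdual_apply \<phi> (T x))"
    using bounded_clinear_compose[OF bounded_clinear_cdual_apply assms]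
    by (simp add: bounded_clinear_def)
  have "Blinfun (\<lambda>x. cdual_apply \<phi> (T x)) \<in>
      {f. \<forall>c x. blinfun_apply f (c *\<^sub>C x) = c * blinfun_apply f x}"
    using assms bounded_clinear_cdual_apply[of \<phi>]
    by (simp add: bounded_linear_Blinfun_apply[OF b] bounded_clinear_def)
  then show ?thesis
    using bounded_linear_Blinfun_apply[OF b]
    by (simp add: cadjoint_def cdual_apply.rep_eq[of "Abs_cdual _"] Abs_cdual_inverse)
qed

lemma bounded_clinear_cadjoint:
  assumes "bounded_clinear T"
  shows "bounded_clinear (cadjoint T)"
proof -
  obtain K where K: "K > 0" "\<And>x. norm (T x) \<le> norm x * K"
    using assms bounded_linear.pos_bounded unfolding bounded_clinear_def by blast
  have "norm (cadjoint T \<phi>) \<le> norm \<phi> * K" for \<phi>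
  proof (rule norm_cdual_bound)
    fix x
    have "cmod (cdual_apply (cadjoint T \<phi>) x) \<le> norm \<phi> * norm (T x)"
      by (simp add: cdual_apply_cadjoint[OF assms] norm_cdual_apply)
    also have "\<dots> \<le> norm \<phi> * (norm x * K)" by (intro mult_left_mono K) simp
    finally show "cmod (cdual_apply (cadjoint T \<phi>) x) \<le> norm \<phi> * K * norm x"
      by (simp add: mult_ac)
  qed (use K in simp)
  then show ?thesis
    unfolding bounded_clinear_def
    by (intro conjI bounded_linear_intro[where K=K] allI cdual_eqI)
      (auto simp: cdual_apply_cadjoint[OF assms])
qed

definition cbidual_embed :: "'a::complex_normed_vector \<Rightarrow> 'a cdual cdual"
  where "cbidual_embed x = Abs_cdual (Blinfun (\<lambda>\<phi>. cdual_apply \<phi> x))"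

lemma cdual_apply_cbidual_embed: "cdual_apply (cbidual_embed x) \<phi> = cdual_apply \<phi> x"
proof -
  have b: "bounded_linear (\<lambda>\<phi>. cdual_apply \<phi> x)"
    by (rule bounded_linear_intro[where K="norm x"]) (simp_all add: norm_cdual_apply)
  have "Blinfun (\<lambda>\<phi>. cdual_apply \<phi> x) \<in>
      {f. \<forall>c x. blinfun_apply f (c *\<^sub>C x) = c * blinfun_apply f x}"
    by (simp add: bounded_linear_Blinfun_apply[OF b])
  then show ?thesis
    using bounded_linear_Blinfun_apply[OF b]
    by (simp add: cbidual_embed_def cdual_apply.rep_eq[of "Abs_cdual _"] Abs_cdual_inverse)
qed


section \<open>The algebraic tensor product\<close>

text \<open>
  The multiset \<open>{#(x\<^sub>1, y\<^sub>1), \<dots>, (x\<^sub>n, y\<^sub>n)#}\<close> stands for the formal sum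
  \<open>x\<^sub>1 \<otimes> y\<^sub>1 + \<dots> + x\<^sub>n \<otimes> y\<^sub>n\<close>; two formal sums denote the same tensor iff they are related by
  the congruence generated by bilinearity.
\<close>

inductive tensor_eq ::
    "('a::complex_vector \<times> 'b::complex_vector) multiset \<Rightarrow> ('a \<times> 'b) multiset \<Rightarrow> bool" where
  tensor_eq_refl: "tensor_eq u u"
| tensor_eq_sym: "tensor_eq u v \<Longrightarrow> tensor_eq v u"
| tensor_eq_trans: "tensor_eq u v \<Longrightarrow> tensor_eq v w \<Longrightarrow> tensor_eq u w"
| tensor_eq_cong: "tensor_eq u v \<Longrightarrow> tensor_eq (u + w) (v + w)"
| tensor_eq_zero: "tensor_eq {#(0, y)#} {#}"
| tensor_eq_add_left: "tensor_eq {#(x + x', y)#} {#(x, y), (x', y)#}"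
| tensor_eq_add_right: "tensor_eq {#(x, y + y')#} {#(x, y), (x, y')#}"
| tensor_eq_scale: "tensor_eq {#(c *\<^sub>C x, y)#} {#(x, c *\<^sub>C y)#}"

quotient_type (overloaded) ('a, 'b) alg_tensor =
    "('a::complex_vector \<times> 'b::complex_vector) multiset" / tensor_eq
  by (intro equivpI reflpI sympI transpI) (fact tensor_eq_refl tensor_eq_sym tensor_eq_trans)+

lemma tensor_eq_plus:
  assumes "tensor_eq u u'" "tensor_eq v v'"
  shows "tensor_eq (u + v) (u' + v')"
proof -
  have "tensor_eq (u + v) (u' + v)" by (rule tensor_eq_cong[OF assms(1)])
  moreover have "tensor_eq (u' + v) (u' + v')"
    using tensor_eq_cong[OF assms(2), of u'] by (simp add: add.commute)
  ultimately show ?thesis by (rule tensor_eq_trans)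
qed

lemma tensor_eq_scaleC:
  assumes "tensor_eq u v"
  shows "tensor_eq (image_mset (\<lambda>(x, y). (c *\<^sub>C x, y)) u) (image_mset (\<lambda>(x, y). (c *\<^sub>C x, y)) v)"
  using assms
proof (induction rule: tensor_eq.induct)
  case (tensor_eq_scale d x y)
  have "tensor_eq {#(d *\<^sub>C (c *\<^sub>C x), y)#} {#(c *\<^sub>C x, d *\<^sub>C y)#}"
    by (rule tensor_eq.tensor_eq_scale)
  then show ?case by (simp add: scaleC_scaleC mult.commute)
qed (auto simp: scaleC_add_right intro: tensor_eq.intros)

instantiation alg_tensor :: (complex_vector, complex_vector) comm_monoid_add
begin

lift_definition zero_alg_tensor :: "('a, 'b) alg_tensor" is "{#}" .
lift_definition plus_alg_tensor :: "('a, 'b) alg_tensor \<Rightarrow> ('a, 'b) alg_tensor \<Rightarrow> ('a, 'b) alg_tensor"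
  is "(+)" by (rule tensor_eq_plus)

instance
  by standard (transfer, simp add: ac_simps tensor_eq_refl)+

end

lift_definition alg_tens :: "'a::complex_vector \<Rightarrow> 'b::complex_vector \<Rightarrow> ('a, 'b) alg_tensor"
  is "\<lambda>x y. {#(x, y)#}" .

instantiation alg_tensor :: (complex_vector, complex_vector) scaleC
begin

lift_definition scaleC_alg_tensor :: "complex \<Rightarrow> ('a, 'b) alg_tensor \<Rightarrow> ('a, 'b) alg_tensor"
  is "\<lambda>c. image_mset (\<lambda>(x, y). (c *\<^sub>C x, y))" by (rule tensor_eq_scaleC)

instance ..

end

lemma alg_tens_add_left: "alg_tens (x + x') y = alg_tens x y + alg_tens x' y"
  by transfer (use tensor_eq_add_left in \<open>simp add: add_mset_commute\<close>)

lemma alg_tens_add_right: "alg_tens x (y + y') = alg_tens x y + alg_tens x y'"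
  by transfer (use tensor_eq_add_right in \<open>simp add: add_mset_commute\<close>)

lemma alg_tens_zero_left: "alg_tens 0 y = 0"
  by transfer (rule tensor_eq_zero)

lemma scaleC_alg_tens: "c *\<^sub>C alg_tens x y = alg_tens (c *\<^sub>C x) y"
  by transfer (simp add: tensor_eq_refl)

lemma alg_tens_scaleC_right: "alg_tens x (c *\<^sub>C y) = alg_tens (c *\<^sub>C x) y"
  by transfer (rule tensor_eq_sym, rule tensor_eq_scale)

lemma scaleC_alg_tensor_add: "c *\<^sub>C (s + t) = c *\<^sub>C s + c *\<^sub>C t" for s t :: "('a::complex_vector, 'b::complex_vector) alg_tensor"
  by transfer (simp add: tensor_eq_refl)

lemma scaleC_alg_tensor_zero: "c *\<^sub>C (0 :: ('a::complex_vector, 'b::complex_vector) alg_tensor) = 0"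
  by transfer (simp add: tensor_eq_refl)

lemma abs_alg_tensor_add_mset: "abs_alg_tensor (add_mset (x, y) m) = alg_tens x y + abs_alg_tensor m"
  by (simp add: alg_tens.abs_eq plus_alg_tensor.abs_eq)

lemma alg_tensor_induct [case_names zero add]:
  assumes "P 0" "\<And>x y t. P t \<Longrightarrow> P (alg_tens x y + t)"
  shows "P t"
proof -
  have "P (abs_alg_tensor m)" for m
  proof (induction m)
    case empty
    then show ?case using assms(1) by (simp add: zero_alg_tensor_def)
  next
    case (add p m)
    then show ?case using assms(2) by (cases p) (simp add: abs_alg_tensor_add_mset)
  qed
  then show ?thesis by (metis Quotient_alg_tensor Quotient_abs_rep)
qed

instantiation alg_tensor :: (complex_vector, complex_vector) complex_vector
begin

definition uminus_alg_tensor :: "('a, 'b) alg_tensor \<Rightarrow> ('a, 'b) alg_tensor"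
  where "uminus_alg_tensor t = (- 1) *\<^sub>C t"
definition minus_alg_tensor :: "('a, 'b) alg_tensor \<Rightarrow> ('a, 'b) alg_tensor \<Rightarrow> ('a, 'b) alg_tensor"
  where "minus_alg_tensor s t = s + - t"
definition scaleR_alg_tensor :: "real \<Rightarrow> ('a, 'b) alg_tensor \<Rightarrow> ('a, 'b) alg_tensor"
  where "scaleR_alg_tensor r t = complex_of_real r *\<^sub>C t"

instance
proof
  fix s t :: "('a, 'b) alg_tensor" and c d :: complex and r q :: real
  have dist: "(c + d) *\<^sub>C t = c *\<^sub>C t + d *\<^sub>C t" for c d and t :: "('a, 'b) alg_tensor"
    by (induction t rule: alg_tensor_induct)
      (simp_all add: scaleC_alg_tensor_zero scaleC_alg_tensor_add scaleC_alg_tens scaleC_add_left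
        alg_tens_add_left ac_simps)
  have one: "1 *\<^sub>C t = t" for t :: "('a, 'b) alg_tensor"
    by (induction t rule: alg_tensor_induct)
      (simp_all add: scaleC_alg_tensor_zero scaleC_alg_tensor_add scaleC_alg_tens)
  have zero: "0 *\<^sub>C t = 0" for t :: "('a, 'b) alg_tensor"
    by (induction t rule: alg_tensor_induct)
      (simp_all add: scaleC_alg_tensor_zero scaleC_alg_tensor_add scaleC_alg_tens alg_tens_zero_left)
  have mul: "c *\<^sub>C d *\<^sub>C t = (c * d) *\<^sub>C t" for c d and t :: "('a, 'b) alg_tensor"
    by (induction t rule: alg_tensor_induct)
      (simp_all add: scaleC_alg_tensor_zero scaleC_alg_tensor_add scaleC_alg_tens scaleC_scaleC)
  show "- t + t = 0"
    using dist[of "- 1" 1 t] by (simp add: one zero uminus_alg_tensor_def)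
  show "s - t = s + - t" by (simp add: minus_alg_tensor_def)
  show "c *\<^sub>C (s + t) = c *\<^sub>C s + c *\<^sub>C t" by (rule scaleC_alg_tensor_add)
  show "(c + d) *\<^sub>C t = c *\<^sub>C t + d *\<^sub>C t" by (rule dist)
  show "c *\<^sub>C d *\<^sub>C t = (c * d) *\<^sub>C t" by (rule mul)
  show "complex_of_real r *\<^sub>C t = r *\<^sub>R t" by (simp add: scaleR_alg_tensor_def)
  show "r *\<^sub>R (s + t) = r *\<^sub>R s + r *\<^sub>R t" "(r + q) *\<^sub>R t = r *\<^sub>R t + q *\<^sub>R t"
    "r *\<^sub>R q *\<^sub>R t = (r * q) *\<^sub>R t" "1 *\<^sub>R t = t"
    by (simp_all add: scaleR_alg_tensor_def scaleC_alg_tensor_add dist mul one)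
qed

end


section \<open>The projective tensor product\<close>

text \<open>
  \<open>proj_norm\<close> is the projective norm on the algebraic tensor product. The completion below identifies
  Cauchy sequences at distance \<open>0\<close>, so definiteness of \<open>proj_norm\<close> (a consequence of Hahn-Banach) is
  not needed to construct it.
\<close>

definition proj_norm :: "('a::complex_normed_vector, 'b::complex_normed_vector) alg_tensor \<Rightarrow> real"
  where "proj_norm t = Inf {\<Sum>(x, y)\<in>#m. norm x * norm y | m. t = abs_alg_tensor m}"

abbreviation mset_norm :: "('a::real_normed_vector \<times> 'b::real_normed_vector) multiset \<Rightarrow> real"
  where "mset_norm m \<equiv> (\<Sum>(x, y)\<in>#m. norm x * norm y)"

lemma mset_norm_nonneg: "0 \<le> mset_norm m"
  by (induction m) auto

lemma proj_norm_le: "t = abs_alg_tensor m \<Longrightarrow> proj_norm t \<le> mset_norm m"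
  unfolding proj_norm_def by (rule cInf_lower) (auto intro!: bdd_belowI mset_norm_nonneg)

lemma alg_tensor_rep_ex: "\<exists>m. t = abs_alg_tensor m"
  by (metis Quotient_alg_tensor Quotient_abs_rep)

lemma proj_norm_greatest:
  "(\<And>m. t = abs_alg_tensor m \<Longrightarrow> b \<le> mset_norm m) \<Longrightarrow> b \<le> proj_norm t"
  unfolding proj_norm_def by (rule cInf_greatest) (use alg_tensor_rep_ex[of t] in auto)

lemma proj_norm_nonneg: "0 \<le> proj_norm t"
  by (rule proj_norm_greatest) (rule mset_norm_nonneg)

lemma proj_norm_alg_tens_le: "proj_norm (alg_tens x y) \<le> norm x * norm y"
  using proj_norm_le[of "alg_tens x y" "{#(x, y)#}"] by (simp add: alg_tens.abs_eq)

lemma proj_norm_zero [simp]: "proj_norm 0 = 0"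
  by (rule antisym[OF _ proj_norm_nonneg])
    (use proj_norm_le[of 0 "{#}"] in \<open>simp add: zero_alg_tensor_def\<close>)

lemma proj_norm_triangle: "proj_norm (s + t) \<le> proj_norm s + proj_norm t"
proof -
  have 1: "proj_norm (s + t) \<le> mset_norm m + mset_norm k"
    if "s = abs_alg_tensor m" "t = abs_alg_tensor k" for m k
    using proj_norm_le[of "s + t" "m + k"] that by (simp add: plus_alg_tensor.abs_eq)
  have "proj_norm (s + t) - mset_norm m \<le> proj_norm t" if "s = abs_alg_tensor m" for m
    by (rule proj_norm_greatest) (use 1 that in fastforce)
  then have "proj_norm (s + t) - proj_norm t \<le> proj_norm s"
    by (intro proj_norm_greatest) fastforce
  then show ?thesis by simp
qed

lemma proj_norm_scaleC: "proj_norm (c *\<^sub>C t) = cmod c * proj_norm t"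
proof -
  have le: "proj_norm (c *\<^sub>C t) \<le> cmod c * proj_norm t" if "c \<noteq> 0"
    for c and t :: "('a, 'b) alg_tensor"
  proof -
    have "proj_norm (c *\<^sub>C t) / cmod c \<le> proj_norm t"
    proof (rule proj_norm_greatest)
      fix m assume t: "t = abs_alg_tensor m"
      have eq: "mset_norm (image_mset (\<lambda>(x, y). (c *\<^sub>C x, y)) m) = cmod c * mset_norm m"
        by (induction m) (auto simp: norm_scaleC algebra_simps)
      have "proj_norm (c *\<^sub>C t) \<le> cmod c * mset_norm m"
        unfolding eq[symmetric]
        by (rule proj_norm_le) (simp add: t scaleC_alg_tensor.abs_eq)
      then show "proj_norm (c *\<^sub>C t) / cmod c \<le> mset_norm m"
        using that by (simp add: field_simps)
    qed
    then show ?thesis using that by (simp add: field_simps)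
  qed
  show ?thesis
  proof (cases "c = 0")
    case False
    have "proj_norm t = proj_norm (inverse c *\<^sub>C c *\<^sub>C t)" using False by (simp add: scaleC_scaleC)
    also have "\<dots> \<le> inverse (cmod c) * proj_norm (c *\<^sub>C t)"
      using le[of "inverse c" "c *\<^sub>C t"] False by (simp add: norm_inverse)
    finally show ?thesis using False le[of c t] by (simp add: field_simps)
  qed simp
qed

lemma proj_norm_scaleR: "proj_norm (r *\<^sub>R t) = \<bar>r\<bar> * proj_norm t"
  using proj_norm_scaleC[of "complex_of_real r" t] by (simp add: scaleC_of_real)

lemma proj_norm_minus [simp]: "proj_norm (- t) = proj_norm t"
  using proj_norm_scaleR[of "- 1" t] by simp

lemma proj_norm_minus_commute: "proj_norm (s - t) = proj_norm (t - s)"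
  using proj_norm_minus[of "s - t"] by simp

lemma proj_norm_diff_triangle: "proj_norm (s - u) \<le> proj_norm (s - t) + proj_norm (t - u)"
  using proj_norm_triangle[of "s - t" "t - u"] by simp

lemma proj_norm_rev_triangle: "\<bar>proj_norm s - proj_norm t\<bar> \<le> proj_norm (s - t)"
  using proj_norm_triangle[of "s - t" t] proj_norm_triangle[of "t - s" s]
  by (simp add: proj_norm_minus_commute[of t s])


definition proj_cauchy ::
    "(nat \<Rightarrow> ('a::complex_normed_vector, 'b::complex_normed_vector) alg_tensor) \<Rightarrow> bool"
  where "proj_cauchy s \<longleftrightarrow> (\<forall>e>0. \<exists>N. \<forall>m\<ge>N. \<forall>n\<ge>N. proj_norm (s m - s n) < e)"

definition ptensor_rel ::
    "(nat \<Rightarrow> ('a::complex_normed_vector, 'b::complex_normed_vector) alg_tensor) \<Rightarrow>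
     (nat \<Rightarrow> ('a, 'b) alg_tensor) \<Rightarrow> bool"
  where "ptensor_rel s t \<longleftrightarrow>
    proj_cauchy s \<and> proj_cauchy t \<and> (\<lambda>n. proj_norm (s n - t n)) \<longlonglongrightarrow> 0"

lemma proj_cauchy_const: "proj_cauchy (\<lambda>_. t)"
  by (simp add: proj_cauchy_def)

lemma proj_null_le:
  assumes "(\<lambda>n. proj_norm (s n)) \<longlonglongrightarrow> 0" "(\<lambda>n. proj_norm (t n)) \<longlonglongrightarrow> 0"
    "\<And>n. proj_norm (u n) \<le> proj_norm (s n) + proj_norm (t n)"
  shows "(\<lambda>n. proj_norm (u n)) \<longlonglongrightarrow> 0"
  by (rule tendsto_sandwich[OF _ _ tendsto_const tendsto_add_zero[OF assms(1,2)]])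
    (simp_all add: assms(3) proj_norm_nonneg)

lemma proj_cauchy_plus:
  assumes "proj_cauchy s" "proj_cauchy t"
  shows "proj_cauchy (\<lambda>n. s n + t n)"
  unfolding proj_cauchy_def
proof (intro allI impI)
  fix e :: real assume "e > 0"
  then obtain M N where M: "\<And>m n. m \<ge> M \<Longrightarrow> n \<ge> M \<Longrightarrow> proj_norm (s m - s n) < e / 2"
    and N: "\<And>m n. m \<ge> N \<Longrightarrow> n \<ge> N \<Longrightarrow> proj_norm (t m - t n) < e / 2"
    using assms unfolding proj_cauchy_def by (meson half_gt_zero)
  have "proj_norm (s m + t m - (s n + t n)) < e" if "m \<ge> max M N" "n \<ge> max M N" for m n
    using proj_norm_triangle[of "s m - s n" "t m - t n"] M[of m n] N[of m n] that
    by (simp add: algebra_simps)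
  then show "\<exists>N. \<forall>m\<ge>N. \<forall>n\<ge>N. proj_norm (s m + t m - (s n + t n)) < e" by blast
qed

lemma proj_cauchy_scaleC:
  assumes "proj_cauchy s"
  shows "proj_cauchy (\<lambda>n. c *\<^sub>C s n)"
  unfolding proj_cauchy_def
proof (intro allI impI)
  fix e :: real assume "e > 0"
  then have "e / (cmod c + 1) > 0" by (simp add: add_nonneg_pos)
  then obtain N where N: "\<And>m n. m \<ge> N \<Longrightarrow> n \<ge> N \<Longrightarrow> proj_norm (s m - s n) < e / (cmod c + 1)"
    using assms unfolding proj_cauchy_def by blast
  have "proj_norm (c *\<^sub>C s m - c *\<^sub>C s n) < e" if "m \<ge> N" "n \<ge> N" for m n
  proof -
    have "c *\<^sub>C s m - c *\<^sub>C s n = c *\<^sub>C (s m - s n)"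
      using scaleC_add_right[of c "s m - s n" "s n"] by (simp add: algebra_simps)
    then have "proj_norm (c *\<^sub>C s m - c *\<^sub>C s n) = cmod c * proj_norm (s m - s n)"
      by (simp add: proj_norm_scaleC)
    also have "\<dots> \<le> (cmod c + 1) * proj_norm (s m - s n)"
      by (intro mult_right_mono) (simp_all add: proj_norm_nonneg)
    also have "\<dots> < e"
      using N[OF that] by (simp add: pos_less_divide_eq add_nonneg_pos mult.commute)
    finally show ?thesis .
  qed
  then show "\<exists>N. \<forall>m\<ge>N. \<forall>n\<ge>N. proj_norm (c *\<^sub>C s m - c *\<^sub>C s n) < e" by blast
qed

lemma ptensor_rel_refl: "proj_cauchy s \<Longrightarrow> ptensor_rel s s"
  by (simp add: ptensor_rel_def)

lemma ptensor_rel_sym: "ptensor_rel s t \<Longrightarrow> ptensor_rel t s"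
  by (simp add: ptensor_rel_def proj_norm_minus_commute)

lemma ptensor_rel_trans: "ptensor_rel s t \<Longrightarrow> ptensor_rel t u \<Longrightarrow> ptensor_rel s u"
  unfolding ptensor_rel_def
  by (auto intro: proj_null_le[OF _ _ proj_norm_diff_triangle])

quotient_type (overloaded) ('a, 'b) ptensor =
    "nat \<Rightarrow> ('a::complex_normed_vector, 'b::complex_normed_vector) alg_tensor" / partial: ptensor_rel
proof (rule part_equivpI)
  show "\<exists>s. ptensor_rel s (s :: nat \<Rightarrow> ('a, 'b) alg_tensor)"
    using ptensor_rel_refl[OF proj_cauchy_const] by blast
  show "symp ptensor_rel" by (rule sympI) (rule ptensor_rel_sym)
  show "transp ptensor_rel" by (rule transpI) (rule ptensor_rel_trans)
qed

lemma ptensor_rel_plus: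
  "ptensor_rel s s' \<Longrightarrow> ptensor_rel t t' \<Longrightarrow> ptensor_rel (\<lambda>n. s n + t n) (\<lambda>n. s' n + t' n)"
  unfolding ptensor_rel_def
  by (auto intro!: proj_cauchy_plus proj_null_le[of "\<lambda>n. s n - s' n" "\<lambda>n. t n - t' n"])
    (use proj_norm_triangle in \<open>metis add_diff_add\<close>)

lemma ptensor_rel_scaleC:
  assumes "ptensor_rel s t"
  shows "ptensor_rel (\<lambda>n. c *\<^sub>C s n) (\<lambda>n. c *\<^sub>C t n)"
proof -
  have "c *\<^sub>C s n - c *\<^sub>C t n = c *\<^sub>C (s n - t n)" for n
    using scaleC_add_right[of c "s n - t n" "t n"] by (simp add: algebra_simps)
  then have "(\<lambda>n. proj_norm (c *\<^sub>C s n - c *\<^sub>C t n)) \<longlonglongrightarrow> 0"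
    using assms by (auto simp: ptensor_rel_def proj_norm_scaleC intro!: tendsto_mult_right_zero)
  then show ?thesis using assms by (simp add: ptensor_rel_def proj_cauchy_scaleC)
qed

lemma proj_cauchy_norm_convergent:
  assumes "proj_cauchy s"
  shows "convergent (\<lambda>n. proj_norm (s n))"
proof (rule Cauchy_convergent, rule metric_CauchyI)
  fix e :: real assume "e > 0"
  then obtain N where "\<forall>m\<ge>N. \<forall>n\<ge>N. proj_norm (s m - s n) < e"
    using assms unfolding proj_cauchy_def by blast
  then show "\<exists>N. \<forall>m\<ge>N. \<forall>n\<ge>N. dist (proj_norm (s m)) (proj_norm (s n)) < e"
    by (metis dist_real_def proj_norm_rev_triangle order_le_less_trans)
qed

lemma ptensor_rel_norm_diff:
  "ptensor_rel s t \<Longrightarrow> (\<lambda>n. proj_norm (s n) - proj_norm (t n)) \<longlonglongrightarrow> 0"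
  unfolding ptensor_rel_def
  by (rule Lim_null_comparison[of _ "\<lambda>n. proj_norm (s n - t n)"])
    (simp_all add: proj_norm_rev_triangle)

lemma ptensor_rel_norm_lim:
  assumes "ptensor_rel s t"
  shows "lim (\<lambda>n. proj_norm (s n)) = lim (\<lambda>n. proj_norm (t n))"
proof -
  have "(\<lambda>n. proj_norm (s n)) \<longlonglongrightarrow> lim (\<lambda>n. proj_norm (s n))"
    using assms proj_cauchy_norm_convergent by (auto simp: ptensor_rel_def convergent_LIMSEQ_iff)
  from tendsto_diff[OF this ptensor_rel_norm_diff[OF assms]]
  show ?thesis by (simp add: limI)
qed

lemma ptensor_cases:
  obtains s where "u = abs_ptensor s" "ptensor_rel s s"
  by (metis Quotient_ptensor Quotient_rep_reflp Quotient_abs_rep)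

instantiation ptensor :: (complex_normed_vector, complex_normed_vector) complex_normed_vector
begin

lift_definition zero_ptensor :: "('a, 'b) ptensor" is "\<lambda>_. 0"
  by (rule ptensor_rel_refl[OF proj_cauchy_const])
lift_definition plus_ptensor :: "('a, 'b) ptensor \<Rightarrow> ('a, 'b) ptensor \<Rightarrow> ('a, 'b) ptensor"
  is "\<lambda>s t n. s n + t n" by (rule ptensor_rel_plus)
lift_definition scaleC_ptensor :: "complex \<Rightarrow> ('a, 'b) ptensor \<Rightarrow> ('a, 'b) ptensor"
  is "\<lambda>c s n. c *\<^sub>C s n" by (rule ptensor_rel_scaleC)
lift_definition norm_ptensor :: "('a, 'b) ptensor \<Rightarrow> real"
  is "\<lambda>s. lim (\<lambda>n. proj_norm (s n))" by (rule ptensor_rel_norm_lim)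

definition uminus_ptensor :: "('a, 'b) ptensor \<Rightarrow> ('a, 'b) ptensor"
  where "uminus_ptensor u = (- 1) *\<^sub>C u"
definition minus_ptensor :: "('a, 'b) ptensor \<Rightarrow> ('a, 'b) ptensor \<Rightarrow> ('a, 'b) ptensor"
  where "minus_ptensor u v = u + - v"
definition scaleR_ptensor :: "real \<Rightarrow> ('a, 'b) ptensor \<Rightarrow> ('a, 'b) ptensor"
  where "scaleR_ptensor r u = complex_of_real r *\<^sub>C u"
definition dist_ptensor :: "('a, 'b) ptensor \<Rightarrow> ('a, 'b) ptensor \<Rightarrow> real"
  where "dist_ptensor u v = norm (u - v)"
definition sgn_ptensor :: "('a, 'b) ptensor \<Rightarrow> ('a, 'b) ptensor"
  where "sgn_ptensor u = inverse (norm u) *\<^sub>R u"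
definition uniformity_ptensor :: "(('a, 'b) ptensor \<times> ('a, 'b) ptensor) filter"
  where "uniformity_ptensor = (INF e\<in>{0<..}. principal {(u, v). dist u v < e})"
definition open_ptensor :: "('a, 'b) ptensor set \<Rightarrow> bool"
  where "open_ptensor U \<longleftrightarrow> (\<forall>x\<in>U. \<forall>\<^sub>F (x', y) in uniformity. x' = x \<longrightarrow> y \<in> U)"

instance
proof
  fix u v w :: "('a, 'b) ptensor" and c d :: complex and r q :: real
  have conv: "(\<lambda>n. proj_norm (s n)) \<longlonglongrightarrow> lim (\<lambda>n. proj_norm (s n))"
    if "ptensor_rel s s" for s :: "nat \<Rightarrow> ('a, 'b) alg_tensor"
    using that proj_cauchy_norm_convergent by (auto simp: ptensor_rel_def convergent_LIMSEQ_iff)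
  note abs_eqs = scaleC_ptensor.abs_eq plus_ptensor.abs_eq zero_ptensor_def norm_ptensor.abs_eq
    ptensor_rel_plus ptensor_rel_scaleC ptensor_rel_refl[OF proj_cauchy_const]
  have scale: "c *\<^sub>C (u + v) = c *\<^sub>C u + c *\<^sub>C v" "(c + d) *\<^sub>C u = c *\<^sub>C u + d *\<^sub>C u"
    "c *\<^sub>C d *\<^sub>C u = (c * d) *\<^sub>C u" "1 *\<^sub>C u = u" "0 *\<^sub>C u = 0"
    for c d and u v :: "('a, 'b) ptensor"
    by (cases u rule: ptensor_cases; cases v rule: ptensor_cases;
        simp add: abs_eqs scaleC_add_right scaleC_add_left scaleC_scaleC)+
  show "u + v + w = u + (v + w)" "u + v = v + u" "0 + u = u"
    by (cases u rule: ptensor_cases; cases v rule: ptensor_cases; cases w rule: ptensor_cases;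
        simp add: abs_eqs ac_simps)+
  show "- u + u = 0"
    using scale(2)[of "- 1" 1 u] by (simp add: uminus_ptensor_def scale)
  show "u - v = u + - v" by (simp add: minus_ptensor_def)
  show "c *\<^sub>C (u + v) = c *\<^sub>C u + c *\<^sub>C v" "(c + d) *\<^sub>C u = c *\<^sub>C u + d *\<^sub>C u"
    "c *\<^sub>C d *\<^sub>C u = (c * d) *\<^sub>C u" "complex_of_real r *\<^sub>C u = r *\<^sub>R u"
    by (fact scale | simp add: scaleR_ptensor_def)+
  show "r *\<^sub>R (u + v) = r *\<^sub>R u + r *\<^sub>R v" "(r + q) *\<^sub>R u = r *\<^sub>R u + q *\<^sub>R u"
    "r *\<^sub>R q *\<^sub>R u = (r * q) *\<^sub>R u" "1 *\<^sub>R u = u"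
    by (simp_all add: scaleR_ptensor_def scale)
  show ns: "norm (c *\<^sub>C u) = cmod c * norm u" for c and u :: "('a, 'b) ptensor"
    by (cases u rule: ptensor_cases)
      (simp add: abs_eqs proj_norm_scaleC limI tendsto_mult_left conv)
  show "norm (r *\<^sub>R u) = \<bar>r\<bar> * norm u" by (simp add: scaleR_ptensor_def ns)
  obtain s where u: "u = abs_ptensor s" and s: "ptensor_rel s s" by (rule ptensor_cases)
  obtain t where v: "v = abs_ptensor t" and t: "ptensor_rel t t" by (rule ptensor_cases)
  have "lim (\<lambda>n. proj_norm (s n + t n)) \<le> lim (\<lambda>n. proj_norm (s n)) + lim (\<lambda>n. proj_norm (t n))"
    by (rule LIMSEQ_le[OF conv[OF ptensor_rel_plus[OF s t]] tendsto_add[OF conv[OF s] conv[OF t]]])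
      (simp add: proj_norm_triangle)
  then show "norm (u + v) \<le> norm u + norm v"
    by (simp add: u v s t abs_eqs)
  have "(lim (\<lambda>n. proj_norm (s n)) = 0) = ptensor_rel s (\<lambda>_. 0)"
  proof
    assume "lim (\<lambda>n. proj_norm (s n)) = 0"
    then show "ptensor_rel s (\<lambda>_. 0)"
      using conv[OF s] s by (simp add: ptensor_rel_def proj_cauchy_const)
  next
    assume "ptensor_rel s (\<lambda>_. 0)"
    then show "lim (\<lambda>n. proj_norm (s n)) = 0"
      by (intro limI) (simp add: ptensor_rel_def)
  qed
  also have "\<dots> = (u = 0)"
    unfolding u zero_ptensor_def
    using Quotient_rel[OF Quotient_ptensor, of s "\<lambda>_. 0"] s
    by (simp add: ptensor_rel_refl[OF proj_cauchy_const])
  finally show "(norm u = 0) = (u = 0)"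
    by (simp add: u s norm_ptensor.abs_eq)
qed (simp_all add: dist_ptensor_def sgn_ptensor_def uniformity_ptensor_def open_ptensor_def)

end

definition ptensor_of ::
    "('a::complex_normed_vector, 'b::complex_normed_vector) alg_tensor \<Rightarrow> ('a, 'b) ptensor"
  where "ptensor_of t = abs_ptensor (\<lambda>_. t)"

definition ptens :: "'a::complex_normed_vector \<Rightarrow> 'b::complex_normed_vector \<Rightarrow> ('a, 'b) ptensor"
    (infixr "\<otimes>" 72)
  where "x \<otimes> y = ptensor_of (alg_tens x y)"

lemma ptensor_rel_const: "ptensor_rel (\<lambda>_. t) (\<lambda>_. t)"
  by (rule ptensor_rel_refl[OF proj_cauchy_const])

lemma ptensor_of_add: "ptensor_of (s + t) = ptensor_of s + ptensor_of t"
  by (simp add: ptensor_of_def plus_ptensor.abs_eq ptensor_rel_const)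

lemma ptensor_of_scaleC: "ptensor_of (c *\<^sub>C t) = c *\<^sub>C ptensor_of t"
  by (simp add: ptensor_of_def scaleC_ptensor.abs_eq ptensor_rel_const)

lemma ptensor_of_zero: "ptensor_of 0 = 0"
  by (simp add: ptensor_of_def zero_ptensor_def)

lemma ptensor_of_diff: "ptensor_of (s - t) = ptensor_of s - ptensor_of t"
  using ptensor_of_add[of "s - t" t] by simp

lemma norm_ptensor_of: "norm (ptensor_of t) = proj_norm t"
  by (simp add: ptensor_of_def norm_ptensor.abs_eq ptensor_rel_const)

lemma ptensor_of_rep_tendsto: "(\<lambda>n. ptensor_of (rep_ptensor u n)) \<longlonglongrightarrow> u"
proof -
  define s where "s = rep_ptensor u"
  have u: "u = abs_ptensor s"
    unfolding s_def by (rule Quotient_abs_rep[OF Quotient_ptensor, symmetric])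
  have rel: "ptensor_rel s s"
    unfolding s_def by (rule Quotient_rep_reflp[OF Quotient_ptensor])
  show ?thesis
    unfolding s_def[symmetric]
  proof (rule LIMSEQ_I)
    fix e :: real assume "e > 0"
    then obtain N where N: "\<forall>m\<ge>N. \<forall>n\<ge>N. proj_norm (s m - s n) < e / 2"
      using rel half_gt_zero unfolding ptensor_rel_def proj_cauchy_def by blast
    have "norm (ptensor_of (s n) - u) < e" if "n \<ge> N" for n
    proof -
      have m: "ptensor_rel (\<lambda>m. (- 1) *\<^sub>C s m) (\<lambda>m. (- 1) *\<^sub>C s m)" by (rule ptensor_rel_scaleC[OF rel])
      have c: "ptensor_rel (\<lambda>_. s n) (\<lambda>_. s n)" by (rule ptensor_rel_refl[OF proj_cauchy_const])
      have r: "ptensor_rel (\<lambda>m. s n + (- 1) *\<^sub>C s m) (\<lambda>m. s n + (- 1) *\<^sub>C s m)"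
        by (rule ptensor_rel_plus[OF c m])
      have mi: "(- 1) *\<^sub>C t = - t" for t :: "('a, 'b) alg_tensor"
        by (simp add: uminus_alg_tensor_def)
      have eq: "ptensor_of (s n) - u = abs_ptensor (\<lambda>m. s n + (- 1) *\<^sub>C s m)"
        unfolding u minus_ptensor_def uminus_ptensor_def
        by (simp add: ptensor_of_def scaleC_ptensor.abs_eq plus_ptensor.abs_eq rel m c)
      have "norm (ptensor_of (s n) - u) = lim (\<lambda>m. proj_norm (s n - s m))"
        using r unfolding eq by (simp add: norm_ptensor.abs_eq mi)
      also have "\<dots> \<le> e / 2"
      proof (rule LIMSEQ_le_const2)
        show "(\<lambda>m. proj_norm (s n - s m)) \<longlonglongrightarrow> lim (\<lambda>m. proj_norm (s n - s m))"
          using proj_cauchy_norm_convergent[of "\<lambda>m. s n - s m"] r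
          by (simp add: ptensor_rel_def mi convergent_LIMSEQ_iff)
        show "\<exists>N. \<forall>m\<ge>N. proj_norm (s n - s m) \<le> e / 2"
          using N that by (meson less_imp_le)
      qed
      also have "\<dots> < e" using \<open>e > 0\<close> by simp
      finally show ?thesis .
    qed
    then show "\<exists>N. \<forall>n\<ge>N. norm (ptensor_of (s n) - u) < e" by blast
  qed
qed

instance ptensor :: (complex_normed_vector, complex_normed_vector) banach
proof
  fix X :: "nat \<Rightarrow> ('a, 'b) ptensor" assume X: "Cauchy X"
  have "\<exists>t. norm (ptensor_of t - X n) < inverse (Suc n)" for n
    using LIMSEQ_D[OF ptensor_of_rep_tendsto[of "X n"], of "inverse (Suc n)"]
    by (metis inverse_positive_iff_positive of_nat_0_less_iff order_refl zero_less_Suc)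
  then obtain t where t: "\<And>n. norm (ptensor_of (t n) - X n) < inverse (Suc n)" by metis
  have null: "(\<lambda>n. ptensor_of (t n) - X n) \<longlonglongrightarrow> 0"
    by (rule Lim_null_comparison[OF _ LIMSEQ_inverse_real_of_nat])
      (intro always_eventually allI less_imp_le t)
  have "proj_cauchy t"
    unfolding proj_cauchy_def
  proof (intro allI impI)
    fix e :: real assume "e > 0"
    then have e: "e / 3 > 0" by simp
    obtain M where M: "\<forall>m\<ge>M. \<forall>n\<ge>M. norm (X m - X n) < e / 3"
      using X e unfolding Cauchy_iff by blast
    obtain N where N: "\<forall>n\<ge>N. norm (ptensor_of (t n) - X n - 0) < e / 3"
      using LIMSEQ_D[OF null e] by blast
    have "proj_norm (t m - t n) < e" if "m \<ge> max M N" "n \<ge> max M N" for m n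
    proof -
      have "norm (X m - X n) < e / 3" "norm (ptensor_of (t m) - X m) < e / 3"
        "norm (ptensor_of (t n) - X n) < e / 3"
        using M N that by simp_all
      moreover have "ptensor_of (t m - t n) =
          (ptensor_of (t m) - X m) + (X m - X n) - (ptensor_of (t n) - X n)"
        by (simp add: ptensor_of_diff)
      ultimately show ?thesis
        using norm_triangle_ineq4[of "(ptensor_of (t m) - X m) + (X m - X n)" "ptensor_of (t n) - X n"]
          norm_triangle_ineq[of "ptensor_of (t m) - X m" "X m - X n"]
        by (simp only: norm_ptensor_of[symmetric])
    qed
    then show "\<exists>N. \<forall>m\<ge>N. \<forall>n\<ge>N. proj_norm (t m - t n) < e" by blast
  qed
  then have rel: "ptensor_rel t t" by (rule ptensor_rel_refl)
  define U where "U = abs_ptensor t"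
  have "ptensor_rel (rep_ptensor U) t"
    unfolding U_def using Quotient_rep_abs[OF Quotient_ptensor, of t] rel by simp
  then have "(\<lambda>n. proj_norm (rep_ptensor U n - t n)) \<longlonglongrightarrow> 0" by (simp add: ptensor_rel_def)
  then have "(\<lambda>n. ptensor_of (rep_ptensor U n) - ptensor_of (t n)) \<longlonglongrightarrow> 0"
    by - (rule tendsto_norm_zero_cancel, simp add: ptensor_of_diff[symmetric] norm_ptensor_of)
  from tendsto_diff[OF ptensor_of_rep_tendsto[of U] tendsto_add[OF this null]]
  have "X \<longlonglongrightarrow> U" by simp
  then show "convergent X" by (auto simp: convergent_def)
qed

lemma bounded_cbilinear_ptens: "bounded_cbilinear ((\<otimes>) :: 'a::complex_normed_vector \<Rightarrow> 'b::complex_normed_vector \<Rightarrow> _)"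
  unfolding bounded_cbilinear_def
proof (intro conjI allI)
  have R: "r *\<^sub>R t = complex_of_real r *\<^sub>C t" for r and t :: "'z::complex_vector"
    by (simp add: scaleC_of_real)
  have l: "(c *\<^sub>C x) \<otimes> y = c *\<^sub>C (x \<otimes> y)" and r: "x \<otimes> (c *\<^sub>C y) = c *\<^sub>C (x \<otimes> y)"
    for c and x :: 'a and y :: 'b
    by (simp_all add: ptens_def ptensor_of_scaleC[symmetric] scaleC_alg_tens alg_tens_scaleC_right)
  fix c and x :: 'a and y :: 'b
  show "(c *\<^sub>C x) \<otimes> y = c *\<^sub>C (x \<otimes> y)" "x \<otimes> (c *\<^sub>C y) = c *\<^sub>C (x \<otimes> y)" by (fact l r)+
  show "bounded_bilinear ((\<otimes>) :: 'a \<Rightarrow> 'b \<Rightarrow> _)"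
  proof
    show "\<exists>K. \<forall>(x::'a) (y::'b). norm (x \<otimes> y) \<le> norm x * norm y * K"
      by (rule exI[of _ 1]) (simp add: ptens_def norm_ptensor_of proj_norm_alg_tens_le)
  qed (simp_all add: R l r, simp_all add: ptens_def ptensor_of_add[symmetric] alg_tens_add_left
      alg_tens_add_right)
qed

text \<open>
  Universal property: bounded bilinear maps into Banach spaces factor uniquely through \<open>\<otimes>\<close>.
  \<open>ptensor_lift f\<close> is the bounded linear map determined by \<open>x \<otimes> y \<mapsto> f x y\<close>.
\<close>

definition ptensor_lift ::
    "('a::complex_normed_vector \<Rightarrow> 'b::complex_normed_vector \<Rightarrow> 'c::{complex_normed_vector, banach})
      \<Rightarrow> ('a, 'b) ptensor \<Rightarrow> 'c"
  where "ptensor_lift f = (THE g. bounded_clinear g \<and> (\<forall>x y. g (x \<otimes> y) = f x y))"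

lemma ptensor_clinear_eqI:
  fixes g h :: "('a::complex_normed_vector, 'b::complex_normed_vector) ptensor \<Rightarrow> 'c::complex_normed_vector"
  assumes "bounded_clinear g" "bounded_clinear h" "\<And>x y. g (x \<otimes> y) = h (x \<otimes> y)"
  shows "g = h"
proof
  fix u
  interpret g: bounded_linear g using assms(1) by (simp add: bounded_clinear_def)
  interpret h: bounded_linear h using assms(2) by (simp add: bounded_clinear_def)
  have "g (ptensor_of t) = h (ptensor_of t)" for t
    by (induction t rule: alg_tensor_induct)
      (simp_all add: ptensor_of_zero ptensor_of_add g.add h.add g.zero h.zero
        assms(3)[unfolded ptens_def])
  then show "g u = h u"
    using g.tendsto[OF ptensor_of_rep_tendsto[of u]] h.tendsto[OF ptensor_of_rep_tendsto[of u]]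
    by (simp add: LIMSEQ_unique)
qed

lemma scaleC_tendsto:
  fixes L :: "'a::complex_normed_vector"
  assumes "X \<longlonglongrightarrow> L"
  shows "(\<lambda>n. c *\<^sub>C X n) \<longlonglongrightarrow> c *\<^sub>C L"
proof (rule LIM_zero_cancel)
  have "c *\<^sub>C X n - c *\<^sub>C L = c *\<^sub>C (X n - L)" for n
    using scaleC_add_right[of c "X n - L" L] by (simp add: algebra_simps)
  moreover have "(\<lambda>n. cmod c * norm (X n - L)) \<longlonglongrightarrow> 0"
    using assms by (intro tendsto_mult_right_zero tendsto_norm_zero) (rule LIM_zero)
  ultimately show "(\<lambda>n. c *\<^sub>C X n - c *\<^sub>C L) \<longlonglongrightarrow> 0"
    by - (rule tendsto_norm_zero_cancel, simp add: norm_scaleC)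
qed

lemma ptensor_lift_ex:
  fixes f :: "'a::complex_normed_vector \<Rightarrow> 'b::complex_normed_vector \<Rightarrow> 'c::{complex_normed_vector, banach}"
  assumes "bounded_cbilinear f"
  shows "\<exists>g. bounded_clinear g \<and> (\<forall>x y. g (x \<otimes> y) = f x y)"
proof -
  interpret f: bounded_bilinear f using assms by (simp add: bounded_cbilinear_def)
  have fl: "f (c *\<^sub>C x) y = c *\<^sub>C f x y" and fr: "f x (c *\<^sub>C y) = c *\<^sub>C f x y" for c x y
    using assms by (auto simp: bounded_cbilinear_def)
  obtain K where K: "K > 0" "\<And>x y. norm (f x y) \<le> norm x * norm y * K"
    using f.pos_bounded by blast
  define S where "S m = (\<Sum>(x, y)\<in>#m. f x y)" for m
  have S_eq: "S m = S k" if "tensor_eq m k" for m k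
    using that by (induction rule: tensor_eq.induct) (simp_all add: S_def f.add_left f.add_right f.zero_left fl fr)
  define F where "F t = S (rep_alg_tensor t)" for t
  have F_abs: "F (abs_alg_tensor m) = S m" for m
    unfolding F_def by (rule S_eq[OF Quotient_rep_abs[OF Quotient_alg_tensor tensor_eq_refl]])
  have F_add: "F (s + t) = F s + F t" for s t
  proof -
    obtain m k where "s = abs_alg_tensor m" "t = abs_alg_tensor k" using alg_tensor_rep_ex by meson
    then show ?thesis by (simp add: plus_alg_tensor.abs_eq F_abs) (simp add: S_def)
  qed
  have F_tens: "F (alg_tens x y) = f x y" for x y
    by (simp add: alg_tens.abs_eq F_abs S_def)
  have F_zero: "F 0 = 0" using F_add[of 0 0] by simp
  have F_scaleC: "F (c *\<^sub>C t) = c *\<^sub>C F t" for c t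
    by (induction t rule: alg_tensor_induct)
      (simp_all only: F_zero F_add F_tens scaleC_add_right scaleC_alg_tens scaleC_zero_right fl)
  have F_diff: "F (s - t) = F s - F t" for s t using F_add[of "s - t" t] by simp
  have F_norm: "norm (F t) \<le> K * proj_norm t" for t
  proof -
    have "norm (F t) / K \<le> proj_norm t"
    proof (rule proj_norm_greatest)
      fix m assume t: "t = abs_alg_tensor m"
      have "norm (S m) \<le> K * mset_norm m"
      proof (induction m)
        case (add p m)
        obtain x y where p: "p = (x, y)" by (cases p)
        have "norm (S (add_mset p m)) \<le> norm (f x y) + norm (S m)"
          by (simp add: S_def p norm_triangle_ineq)
        also have "\<dots> \<le> norm x * norm y * K + K * mset_norm m"
          by (intro add_mono K add.IH)
        finally show ?case by (simp add: p algebra_simps)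
      qed (simp add: S_def)
      then show "norm (F t) / K \<le> mset_norm m" using K(1) by (simp add: t F_abs field_simps)
    qed
    then show ?thesis using K(1) by (simp add: field_simps)
  qed
  define g where "g u = lim (\<lambda>n. F (rep_ptensor u n))" for u
  have g_lim: "(\<lambda>n. F (s n)) \<longlonglongrightarrow> g u" if "(\<lambda>n. ptensor_of (s n)) \<longlonglongrightarrow> u" for s u
  proof -
    have diff: "(\<lambda>n. F (s n) - F (rep_ptensor u n)) \<longlonglongrightarrow> 0"
    proof (rule Lim_null_comparison)
      show "\<forall>\<^sub>F n in sequentially. norm (F (s n) - F (rep_ptensor u n))
          \<le> K * norm (ptensor_of (s n) - ptensor_of (rep_ptensor u n))"
        by (simp add: F_diff[symmetric] ptensor_of_diff[symmetric] norm_ptensor_of F_norm)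
      show "(\<lambda>n. K * norm (ptensor_of (s n) - ptensor_of (rep_ptensor u n))) \<longlonglongrightarrow> 0"
        using tendsto_diff[OF that ptensor_of_rep_tendsto[of u]]
        by (intro tendsto_mult_right_zero tendsto_norm_zero) simp
    qed
    have "Cauchy (\<lambda>n. F (rep_ptensor u n))"
    proof (rule CauchyI)
      fix e :: real assume "e > 0"
      then have "e / K > 0" using K(1) by simp
      then obtain N where N: "\<forall>m\<ge>N. \<forall>n\<ge>N.
          norm (ptensor_of (rep_ptensor u m) - ptensor_of (rep_ptensor u n)) < e / K"
        using LIMSEQ_imp_Cauchy[OF ptensor_of_rep_tendsto[of u]] unfolding Cauchy_iff by blast
      have "norm (F (rep_ptensor u m) - F (rep_ptensor u n)) < e" if "m \<ge> N" "n \<ge> N" for m n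
      proof -
        have "norm (F (rep_ptensor u m) - F (rep_ptensor u n))
            \<le> K * proj_norm (rep_ptensor u m - rep_ptensor u n)"
          unfolding F_diff[symmetric] by (rule F_norm)
        also have "\<dots> < e"
          using N that K(1) by (simp add: ptensor_of_diff[symmetric] norm_ptensor_of field_simps)
        finally show ?thesis .
      qed
      then show "\<exists>M. \<forall>m\<ge>M. \<forall>n\<ge>M. norm (F (rep_ptensor u m) - F (rep_ptensor u n)) < e" by blast
    qed
    then have "(\<lambda>n. F (rep_ptensor u n)) \<longlonglongrightarrow> g u"
      unfolding g_def by (simp add: Cauchy_convergent_iff convergent_LIMSEQ_iff)
    from tendsto_add[OF diff this] show ?thesis by simp
  qed
  have g_of: "g (ptensor_of t) = F t" for t
    using g_lim[of "\<lambda>_. t"] by (simp add: LIMSEQ_const_iff)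
  have g_add: "g (u + v) = g u + g v" for u v
  proof (rule LIMSEQ_unique[OF g_lim])
    show "(\<lambda>n. ptensor_of (rep_ptensor u n + rep_ptensor v n)) \<longlonglongrightarrow> u + v"
      unfolding ptensor_of_add by (intro tendsto_add ptensor_of_rep_tendsto)
    show "(\<lambda>n. F (rep_ptensor u n + rep_ptensor v n)) \<longlonglongrightarrow> g u + g v"
      unfolding F_add by (intro tendsto_add g_lim ptensor_of_rep_tendsto)
  qed
  have g_scaleC: "g (c *\<^sub>C u) = c *\<^sub>C g u" for c u
  proof (rule LIMSEQ_unique[OF g_lim])
    show "(\<lambda>n. ptensor_of (c *\<^sub>C rep_ptensor u n)) \<longlonglongrightarrow> c *\<^sub>C u"
      unfolding ptensor_of_scaleC by (intro scaleC_tendsto ptensor_of_rep_tendsto)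
    show "(\<lambda>n. F (c *\<^sub>C rep_ptensor u n)) \<longlonglongrightarrow> c *\<^sub>C g u"
      unfolding F_scaleC by (intro scaleC_tendsto g_lim ptensor_of_rep_tendsto)
  qed
  have g_norm: "norm (g u) \<le> norm u * K" for u
  proof (rule LIMSEQ_le)
    show "(\<lambda>n. norm (F (rep_ptensor u n))) \<longlonglongrightarrow> norm (g u)"
      by (intro tendsto_norm g_lim ptensor_of_rep_tendsto)
    show "(\<lambda>n. norm (ptensor_of (rep_ptensor u n)) * K) \<longlonglongrightarrow> norm u * K"
      by (intro tendsto_intros ptensor_of_rep_tendsto)
    show "\<exists>N. \<forall>n\<ge>N. norm (F (rep_ptensor u n)) \<le> norm (ptensor_of (rep_ptensor u n)) * K"
      using F_norm by (simp add: norm_ptensor_of mult.commute)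
  qed
  have "bounded_clinear g"
    unfolding bounded_clinear_def
  proof (intro conjI allI g_scaleC bounded_linear_intro[where K=K] g_add g_norm)
    show "g (r *\<^sub>R u) = r *\<^sub>R g u" for r u
      using g_scaleC[of "complex_of_real r" u] by (simp add: scaleC_of_real)
  qed
  moreover have "g (x \<otimes> y) = f x y" for x y
    by (simp add: ptens_def g_of F_tens)
  ultimately show ?thesis by blast
qed

lemma
  assumes "bounded_cbilinear f"
  shows bounded_clinear_ptensor_lift: "bounded_clinear (ptensor_lift f)"
    and ptensor_lift_ptens: "ptensor_lift f (x \<otimes> y) = f x y"
proof -
  have "\<exists>!g. bounded_clinear g \<and> (\<forall>x y. g (x \<otimes> y) = f x y)"
    using ptensor_lift_ex[OF assms] ptensor_clinear_eqI by (metis (no_types, lifting))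
  from theI'[OF this] show "bounded_clinear (ptensor_lift f)" "ptensor_lift f (x \<otimes> y) = f x y"
    by (auto simp: ptensor_lift_def)
qed


section \<open>Bimodules over a Banach algebra\<close>

text \<open>
  A bimodule structure on \<open>X\<close> is given by its left action \<open>l :: 'a \<Rightarrow> 'x \<Rightarrow> 'x\<close> and its right action
  \<open>r :: 'x \<Rightarrow> 'a \<Rightarrow> 'x\<close>. The left action on \<open>X\<^sup>*\<close> comes from the right action on \<open>X\<close> and vice versa:
  \<open>\<langle>a \<cdot> \<phi>, x\<rangle> = \<langle>\<phi>, x \<cdot> a\<rangle>\<close> and \<open>\<langle>\<phi> \<cdot> a, x\<rangle> = \<langle>\<phi>, a \<cdot> x\<rangle>\<close>.
\<close>

definition dual_left ::
    "('x::complex_normed_vector \<Rightarrow> 'a \<Rightarrow> 'x) \<Rightarrow> 'a \<Rightarrow> 'x cdual \<Rightarrow> 'x cdual"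
  where "dual_left r a \<phi> = cadjoint (\<lambda>x. r x a) \<phi>"

definition dual_right ::
    "('a \<Rightarrow> 'x::complex_normed_vector \<Rightarrow> 'x) \<Rightarrow> 'x cdual \<Rightarrow> 'a \<Rightarrow> 'x cdual"
  where "dual_right l \<phi> a = cadjoint (l a) \<phi>"

definition tensor_left ::
    "'a::complex_normed_algebra \<Rightarrow> ('a, 'a) ptensor \<Rightarrow> ('a, 'a) ptensor"
  where "tensor_left a = ptensor_lift (\<lambda>b c. (a * b) \<otimes> c)"

definition tensor_right ::
    "('a, 'a) ptensor \<Rightarrow> 'a::complex_normed_algebra \<Rightarrow> ('a, 'a) ptensor"
  where "tensor_right u a = ptensor_lift (\<lambda>b c. b \<otimes> (c * a)) u"

definition diagonal_operator ::
    "('a, 'a) ptensor \<Rightarrow> 'a::{complex_normed_algebra, banach}"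
  where "diagonal_operator = ptensor_lift (*)"

lemma bounded_clinear_mult:
  fixes a :: "'a::complex_normed_algebra"
  shows "bounded_clinear ((*) a)" "bounded_clinear (\<lambda>x. x * a)"
  by (simp_all add: bounded_clinear_def bounded_linear_mult_left bounded_linear_mult_right
      mult_scaleC_left mult_scaleC_right)

lemma bounded_cbilinear_compose:
  assumes "bounded_cbilinear f" "bounded_clinear g" "bounded_clinear h"
  shows "bounded_cbilinear (\<lambda>x y. f (g x) (h y))"
  using assms unfolding bounded_cbilinear_def bounded_clinear_def
  by (auto intro: bounded_bilinear.comp)

lemma bounded_clinear_id: "bounded_clinear (\<lambda>x. x)"
  by (simp add: bounded_clinear_def)

lemma
  fixes a :: "'a::complex_normed_algebra"
  shows bounded_clinear_tensor_left: "bounded_clinear (tensor_left a)"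
    and tensor_left_ptens: "tensor_left a (b \<otimes> c) = (a * b) \<otimes> c"
  using bounded_clinear_ptensor_lift ptensor_lift_ptens
    bounded_cbilinear_compose[OF bounded_cbilinear_ptens bounded_clinear_mult(1)[of a] bounded_clinear_id]
  unfolding tensor_left_def by blast+

lemma
  fixes a :: "'a::complex_normed_algebra"
  shows bounded_clinear_tensor_right: "bounded_clinear (\<lambda>u. tensor_right u a)"
    and tensor_right_ptens: "tensor_right (b \<otimes> c) a = b \<otimes> (c * a)"
  using bounded_clinear_ptensor_lift ptensor_lift_ptens
    bounded_cbilinear_compose[OF bounded_cbilinear_ptens bounded_clinear_id bounded_clinear_mult(2)[of a]]
  unfolding tensor_right_def by blast+

lemma
  fixes b c :: "'a::{complex_normed_algebra, banach}"
  shows bounded_clinear_diagonal_operator: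
      "bounded_clinear (diagonal_operator :: ('a, 'a) ptensor \<Rightarrow> 'a)"
    and diagonal_operator_ptens: "diagonal_operator (b \<otimes> c) = b * c"
proof -
  have "bounded_cbilinear ((*) :: 'a \<Rightarrow> 'a \<Rightarrow> 'a)"
    by (simp add: bounded_cbilinear_def bounded_bilinear_mult mult_scaleC_left mult_scaleC_right)
  then show "bounded_clinear (diagonal_operator :: ('a, 'a) ptensor \<Rightarrow> 'a)"
    "diagonal_operator (b \<otimes> c) = b * c"
    by (simp_all add: diagonal_operator_def bounded_clinear_ptensor_lift ptensor_lift_ptens)
qed


section \<open>Virtual diagonals and biflatness relative to an endomorphism\<close>

definition Hom :: "('a::{complex_normed_algebra, banach} \<Rightarrow> 'a) set"
  where "Hom = {\<sigma>. (\<forall>a b. \<sigma> (a + b) = \<sigma> a + \<sigma> b) \<and> (\<forall>c a. \<sigma> (c *\<^sub>C a) = c *\<^sub>C \<sigma> a) \<and>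
    (\<forall>a b. \<sigma> (a * b) = \<sigma> a * \<sigma> b) \<and> continuous_on UNIV \<sigma>}"

text \<open>
  The module actions of the algebra on \<open>(A \<otimes> A)\<^sup>*\<close>, \<open>(A \<otimes> A)\<^sup>*\<^sup>*\<close>, \<open>A\<^sup>*\<close> and \<open>A\<^sup>*\<^sup>*\<close>, where \<open>A\<close> is a
  bimodule over itself by multiplication.
\<close>

abbreviation "tensor_dual_left \<equiv> dual_left tensor_right"
abbreviation "tensor_dual_right \<equiv> dual_right tensor_left"
abbreviation "tensor_bidual_left \<equiv> dual_left tensor_dual_right"
abbreviation "tensor_bidual_right \<equiv> dual_right tensor_dual_left"
abbreviation "alg_dual_left \<equiv> dual_left (*)"
abbreviation "alg_dual_right \<equiv> dual_right (*)"
abbreviation "alg_bidual_right \<equiv> dual_right alg_dual_left"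

definition sigma_virtual_diagonal ::
    "('a::{complex_normed_algebra, banach} \<Rightarrow> 'a) \<Rightarrow> ('a, 'a) ptensor cdual cdual \<Rightarrow> bool"
  where "sigma_virtual_diagonal \<sigma> M \<longleftrightarrow>
    (\<forall>a. tensor_bidual_left (\<sigma> a) M = tensor_bidual_right M (\<sigma> a)) \<and>
    (\<forall>a. alg_bidual_right (cadjoint (cadjoint diagonal_operator) M) (\<sigma> a) = cbidual_embed (\<sigma> a))"

definition sigma_biflat :: "('a::{complex_normed_algebra, banach} \<Rightarrow> 'a) \<Rightarrow> bool"
  where "sigma_biflat \<sigma> \<longleftrightarrow> (\<exists>\<rho> :: ('a, 'a) ptensor cdual \<Rightarrow> 'a cdual.
    bounded_clinear \<rho> \<and>
    (\<forall>a \<phi>. \<rho> (tensor_dual_left (\<sigma> a) \<phi>) = alg_dual_left a (\<rho> \<phi>)) \<and>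
    (\<forall>a \<phi>. \<rho> (tensor_dual_right \<phi> (\<sigma> a)) = alg_dual_right (\<rho> \<phi>) a) \<and>
    \<rho> \<circ> cadjoint diagonal_operator = cadjoint \<sigma>)"

lemma bounded_clinear_Hom:
  assumes "\<sigma> \<in> Hom"
  shows "bounded_clinear \<sigma>"
proof -
  have R: "\<sigma> (r *\<^sub>R x) = r *\<^sub>R \<sigma> x" for r x
    using assms by (simp add: Hom_def flip: scaleC_of_real)
  then have "linear \<sigma>"
    using assms by (intro linearI) (auto simp: Hom_def)
  then interpret linear \<sigma> .
  have "isCont \<sigma> 0"
    using assms by (simp add: Hom_def continuous_on_eq_continuous_at)
  then obtain d where d: "d > 0" "\<forall>y. dist y 0 < d \<longrightarrow> dist (\<sigma> y) (\<sigma> 0) < 1"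
    using zero_less_one unfolding continuous_at_eps_delta by blast
  then have less: "norm (\<sigma> y) < 1" if "norm y < d" for y
    using that by (simp add: zero)
  have "norm (\<sigma> x) \<le> norm x * (2 / d)" for x
  proof (cases "x = 0")
    case False
    have "norm (\<sigma> ((d / 2 / norm x) *\<^sub>R x)) < 1" using d(1) False by (intro less) simp
    then show ?thesis using d(1) False by (simp add: R field_simps)
  qed (simp add: zero)
  then show ?thesis
    using assms R unfolding bounded_clinear_def Hom_def
    by (auto intro!: bounded_linear_intro[where K="2 / d"])
qed

end

theory Submission
  imports Defs
begin

text \<open>
  Given a \<open>\<sigma>\<close>-virtual diagonal \<open>M\<close>, the map witnessing \<open>\<sigma>\<close>-biflatness is
  \<open>\<langle>\<rho>(\<phi>), x\<rangle> = \<langle>M, \<sigma>(x) \<cdot> \<phi>\<rangle>\<close>, and since \<open>M\<close> commutes with the range of \<open>\<sigma>\<close>, this is also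
  \<open>\<langle>M, \<phi> \<cdot> \<sigma>(x)\<rangle>\<close>. The first formula gives the left module property, because
  \<open>\<sigma>(x) \<cdot> (\<sigma>(a) \<cdot> \<phi>) = \<sigma>(x a) \<cdot> \<phi>\<close>; the second formula gives the right one, because
  \<open>(\<phi> \<cdot> \<sigma>(a)) \<cdot> \<sigma>(x) = \<phi> \<cdot> \<sigma>(a x)\<close>. Finally \<open>\<pi>\<^sup>*\<close> is a left module map, so
  \<open>\<langle>\<rho>(\<pi>\<^sup>*(\<psi>)), x\<rangle> = \<langle>M, \<pi>\<^sup>*(\<sigma>(x) \<cdot> \<psi>)\<rangle> = \<langle>\<pi>\<^sup>*\<^sup>*(M) \<cdot> \<sigma>(x), \<psi>\<rangle> = \<langle>\<psi>, \<sigma>(x)\<rangle>\<close>.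

  Boundedness of \<open>\<rho>\<close> rests on the estimate \<open>\<parallel>u \<cdot> a\<parallel> \<le> \<parallel>a\<parallel> \<parallel>u\<parallel>\<close> in the projective tensor product
  (\<open>norm_tensor_right\<close>), an instance of the fact that a bounded linear map on the projective tensor
  product is bounded by its bound on elementary tensors (\<open>norm_le_of_ptens\<close>).
\<close>

section \<open>The module actions on the projective tensor product\<close>

lemma norm_le_of_ptens:
  fixes g :: "('a::complex_normed_vector, 'b::complex_normed_vector) ptensor \<Rightarrow> 'c::complex_normed_vector"
  assumes g: "bounded_clinear g" and K: "0 \<le> K"
    and le: "\<And>x y. norm (g (x \<otimes> y)) \<le> K * (norm x * norm y)"
  shows "norm (g u) \<le> K * norm u"
proof -
  interpret g: bounded_linear g using g by (simp add: bounded_clinear_def)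
  have mset: "norm (g (ptensor_of (abs_alg_tensor m))) \<le> K * mset_norm m" for m
  proof (induction m)
    case empty
    show ?case by (simp add: zero_alg_tensor_def[symmetric] ptensor_of_zero g.zero)
  next
    case (add p m)
    obtain x y where p: "p = (x, y)" by (cases p)
    have "norm (g (ptensor_of (abs_alg_tensor (add_mset p m))))
        \<le> norm (g (x \<otimes> y)) + norm (g (ptensor_of (abs_alg_tensor m)))"
      by (simp add: p abs_alg_tensor_add_mset ptensor_of_add g.add ptens_def norm_triangle_ineq)
    also have "\<dots> \<le> K * (norm x * norm y) + K * mset_norm m"
      by (intro add_mono le add.IH)
    finally show ?case by (simp add: p algebra_simps)
  qed
  have alg: "norm (g (ptensor_of t)) \<le> K * norm (ptensor_of t)" for t
  proof (cases "K = 0")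
    case True
    then show ?thesis using mset alg_tensor_rep_ex[of t] by auto
  next
    case False
    have "norm (g (ptensor_of t)) / K \<le> proj_norm t"
    proof (rule proj_norm_greatest)
      fix m assume "t = abs_alg_tensor m"
      then show "norm (g (ptensor_of t)) / K \<le> mset_norm m"
        using False K mset[of m] by (simp add: field_simps)
    qed
    then show ?thesis using False K by (simp add: norm_ptensor_of field_simps)
  qed
  \<comment> \<open>Algebraic tensors are dense, so the estimate passes to the limit.\<close>
  show ?thesis
  proof (rule LIMSEQ_le)
    show "(\<lambda>n. norm (g (ptensor_of (rep_ptensor u n)))) \<longlonglongrightarrow> norm (g u)"
      by (intro tendsto_norm g.tendsto ptensor_of_rep_tendsto)
    show "(\<lambda>n. K * norm (ptensor_of (rep_ptensor u n))) \<longlonglongrightarrow> K * norm u"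
      by (intro tendsto_intros ptensor_of_rep_tendsto)
  qed (use alg in blast)
qed

lemma norm_ptens_le: "norm (x \<otimes> y) \<le> norm x * norm y"
  by (simp add: ptens_def norm_ptensor_of proj_norm_alg_tens_le)

lemma norm_tensor_right: "norm (tensor_right u a) \<le> norm a * norm u"
proof (rule norm_le_of_ptens[OF bounded_clinear_tensor_right])
  fix b c
  have "norm (tensor_right (b \<otimes> c) a) \<le> norm b * norm (c * a)"
    by (simp add: tensor_right_ptens norm_ptens_le)
  also have "\<dots> \<le> norm b * (norm c * norm a)"
    by (intro mult_left_mono norm_mult_ineq) simp
  finally show "norm (tensor_right (b \<otimes> c) a) \<le> norm a * (norm b * norm c)"
    by (simp add: mult_ac)
qed simp

lemma tensor_right_right: "tensor_right (tensor_right u a) b = tensor_right u (a * b)"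
proof -
  have "(\<lambda>u. tensor_right (tensor_right u a) b) = (\<lambda>u. tensor_right u (a * b))"
    by (intro ptensor_clinear_eqI bounded_clinear_tensor_right
        bounded_clinear_compose[OF bounded_clinear_tensor_right bounded_clinear_tensor_right])
      (simp add: tensor_right_ptens mult.assoc)
  then show ?thesis by (rule fun_cong)
qed

lemma tensor_left_left: "tensor_left a (tensor_left b u) = tensor_left (a * b) u"
proof -
  have "(\<lambda>u. tensor_left a (tensor_left b u)) = tensor_left (a * b)"
    by (intro ptensor_clinear_eqI bounded_clinear_tensor_left
        bounded_clinear_compose[OF bounded_clinear_tensor_left bounded_clinear_tensor_left])
      (simp add: tensor_left_ptens mult.assoc)
  then show ?thesis by (rule fun_cong)
qed

lemma bounded_clinear_add:
  assumes "bounded_clinear f" "bounded_clinear g"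
  shows "bounded_clinear (\<lambda>x. f x + g x)"
  using assms by (simp add: bounded_clinear_def bounded_linear_add scaleC_add_right)

lemma bounded_clinear_scaleC: "bounded_clinear ((*\<^sub>C) c :: 'a::complex_normed_vector \<Rightarrow> 'a)"
proof -
  have "c *\<^sub>C r *\<^sub>R x = r *\<^sub>R c *\<^sub>C x" for r and x :: 'a
    by (simp add: scaleC_scaleC mult.commute flip: scaleC_of_real)
  then show ?thesis
    unfolding bounded_clinear_def
    by (auto intro!: bounded_linear_intro[where K="cmod c"]
        simp: scaleC_add_right norm_scaleC scaleC_scaleC mult.commute)
qed

lemma tensor_right_add:
  fixes a b :: "'a::complex_normed_algebra"
  shows "tensor_right u (a + b) = tensor_right u a + tensor_right u b"
proof -
  interpret t: bounded_bilinear "(\<otimes>) :: 'a \<Rightarrow> 'a \<Rightarrow> _"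
    using bounded_cbilinear_ptens[where 'a='a and 'b='a] by (simp add: bounded_cbilinear_def)
  have "(\<lambda>u. tensor_right u (a + b)) = (\<lambda>u. tensor_right u a + tensor_right u b)"
    by (intro ptensor_clinear_eqI bounded_clinear_tensor_right
        bounded_clinear_add[OF bounded_clinear_tensor_right bounded_clinear_tensor_right])
      (simp add: tensor_right_ptens distrib_left t.add_right)
  then show ?thesis by (rule fun_cong)
qed

lemma tensor_right_scaleC:
  fixes a :: "'a::complex_normed_algebra"
  shows "tensor_right u (c *\<^sub>C a) = c *\<^sub>C tensor_right u a"
proof -
  have "(\<lambda>u. tensor_right u (c *\<^sub>C a)) = (\<lambda>u. c *\<^sub>C tensor_right u a)"
    using bounded_cbilinear_ptens[where 'a='a and 'b='a]
    by (intro ptensor_clinear_eqI bounded_clinear_tensor_right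
        bounded_clinear_compose[OF bounded_clinear_scaleC bounded_clinear_tensor_right])
      (simp add: tensor_right_ptens mult_scaleC_right bounded_cbilinear_def)
  then show ?thesis by (rule fun_cong)
qed

lemma diagonal_operator_tensor_right: "diagonal_operator (tensor_right u a) = diagonal_operator u * a"
proof -
  have "(\<lambda>u. diagonal_operator (tensor_right u a)) = (\<lambda>u. diagonal_operator u * a)"
    by (intro ptensor_clinear_eqI
        bounded_clinear_compose[OF bounded_clinear_diagonal_operator bounded_clinear_tensor_right]
        bounded_clinear_compose[OF bounded_clinear_mult(2) bounded_clinear_diagonal_operator])
      (simp add: tensor_right_ptens diagonal_operator_ptens mult.assoc)
  then show ?thesis by (rule fun_cong)
qed

section \<open>The dual actions\<close>

lemma bounded_clinear_dual_left:
  "bounded_clinear (\<lambda>x. r x a) \<Longrightarrow> bounded_clinear (dual_left r a)"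
  unfolding dual_left_def by (rule bounded_clinear_cadjoint)

lemma bounded_clinear_dual_right:
  "bounded_clinear (l a) \<Longrightarrow> bounded_clinear (\<lambda>\<phi>. dual_right l \<phi> a)"
  unfolding dual_right_def by (rule bounded_clinear_cadjoint)

lemma cdual_apply_dual_left:
  "bounded_clinear (\<lambda>x. r x a) \<Longrightarrow> cdual_apply (dual_left r a \<phi>) x = cdual_apply \<phi> (r x a)"
  by (simp add: dual_left_def cdual_apply_cadjoint)

lemma cdual_apply_dual_right:
  "bounded_clinear (l a) \<Longrightarrow> cdual_apply (dual_right l \<phi> a) x = cdual_apply \<phi> (l a x)"
  by (simp add: dual_right_def cdual_apply_cadjoint)

lemmas cdual_apply_tensor_dual_left = cdual_apply_dual_left[OF bounded_clinear_tensor_right]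
lemmas cdual_apply_tensor_dual_right = cdual_apply_dual_right[OF bounded_clinear_tensor_left]
lemmas cdual_apply_alg_dual_left = cdual_apply_dual_left[where r="(*)", OF bounded_clinear_mult(2)]
lemmas cdual_apply_alg_dual_right = cdual_apply_dual_right[where l="(*)", OF bounded_clinear_mult(1)]
lemmas cdual_apply_tensor_bidual_left =
  cdual_apply_dual_left[where r=tensor_dual_right,
    OF bounded_clinear_dual_right[OF bounded_clinear_tensor_left]]
lemmas cdual_apply_tensor_bidual_right =
  cdual_apply_dual_right[where l=tensor_dual_left,
    OF bounded_clinear_dual_left[OF bounded_clinear_tensor_right]]
lemmas cdual_apply_alg_bidual_right =
  cdual_apply_dual_right[where l=alg_dual_left,
    OF bounded_clinear_dual_left[where r="(*)", OF bounded_clinear_mult(2)]]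

lemma tensor_dual_left_left:
  "tensor_dual_left a (tensor_dual_left b \<phi>) = tensor_dual_left (a * b) \<phi>"
  by (rule cdual_eqI) (simp add: cdual_apply_tensor_dual_left tensor_right_right)

lemma tensor_dual_right_right:
  "tensor_dual_right (tensor_dual_right \<phi> a) b = tensor_dual_right \<phi> (a * b)"
  by (rule cdual_eqI) (simp add: cdual_apply_tensor_dual_right tensor_left_left)

lemma tensor_dual_left_cadjoint_diagonal:
  "tensor_dual_left a (cadjoint diagonal_operator \<psi>) = cadjoint diagonal_operator (alg_dual_left a \<psi>)"
  by (rule cdual_eqI)
    (simp add: cdual_apply_tensor_dual_left cdual_apply_alg_dual_left
      cdual_apply_cadjoint[OF bounded_clinear_diagonal_operator] diagonal_operator_tensor_right)

lemma norm_tensor_dual_left: "norm (tensor_dual_left a \<phi>) \<le> norm a * norm \<phi>"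
proof (rule norm_cdual_bound)
  fix u
  have "cmod (cdual_apply (tensor_dual_left a \<phi>) u) \<le> norm \<phi> * norm (tensor_right u a)"
    by (simp add: cdual_apply_tensor_dual_left norm_cdual_apply)
  also have "\<dots> \<le> norm \<phi> * (norm a * norm u)"
    by (intro mult_left_mono norm_tensor_right) simp
  finally show "cmod (cdual_apply (tensor_dual_left a \<phi>) u) \<le> norm a * norm \<phi> * norm u"
    by (simp add: mult_ac)
qed simp

lemma bounded_clinear_orbit: "bounded_clinear (\<lambda>a. tensor_dual_left a \<phi>)"
proof -
  interpret \<phi>: bounded_linear "cdual_apply \<phi>"
    using bounded_clinear_cdual_apply[of \<phi>] by (simp add: bounded_clinear_def)
  have add: "tensor_dual_left (a + b) \<phi> = tensor_dual_left a \<phi> + tensor_dual_left b \<phi>" for a b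
    by (rule cdual_eqI) (simp add: cdual_apply_tensor_dual_left tensor_right_add \<phi>.add)
  have scaleC: "tensor_dual_left (c *\<^sub>C a) \<phi> = c *\<^sub>C tensor_dual_left a \<phi>" for c a
    using bounded_clinear_cdual_apply[of \<phi>]
    by (intro cdual_eqI)
      (simp add: cdual_apply_tensor_dual_left tensor_right_scaleC bounded_clinear_def)
  have "tensor_dual_left (r *\<^sub>R a) \<phi> = r *\<^sub>R tensor_dual_left a \<phi>" for r a
    using scaleC[of "complex_of_real r" a] by (simp add: scaleC_of_real)
  then show ?thesis
    unfolding bounded_clinear_def
    by (intro conjI allI bounded_linear_intro[where K="norm \<phi>"] add scaleC norm_tensor_dual_left)
qed

section \<open>From a virtual diagonal to biflatness\<close>

text \<open>\<open>tensor_slice M \<phi>\<close> is the functional \<open>x \<mapsto> \<langle>M, x \<cdot> \<phi>\<rangle>\<close> on \<open>A\<close>.\<close>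

definition tensor_slice ::
    "('a::complex_normed_algebra, 'a) ptensor cdual cdual \<Rightarrow> ('a, 'a) ptensor cdual \<Rightarrow> 'a cdual"
  where "tensor_slice M \<phi> = cadjoint (\<lambda>x. tensor_dual_left x \<phi>) M"

lemma cdual_apply_tensor_slice:
  "cdual_apply (tensor_slice M \<phi>) x = cdual_apply M (tensor_dual_left x \<phi>)"
  by (simp add: tensor_slice_def cdual_apply_cadjoint[OF bounded_clinear_orbit])

lemma bounded_clinear_tensor_slice:
  fixes M :: "('a::complex_normed_algebra, 'a) ptensor cdual cdual"
  shows "bounded_clinear (tensor_slice M)"
proof -
  interpret M: bounded_linear "cdual_apply M"
    using bounded_clinear_cdual_apply[of M] by (simp add: bounded_clinear_def)
  interpret L: bounded_linear "tensor_dual_left a" for a :: 'a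
    using bounded_clinear_dual_left[of tensor_right, OF bounded_clinear_tensor_right[where 'a='a]]
    by (simp add: bounded_clinear_def)
  have add: "tensor_slice M (\<phi> + \<psi>) = tensor_slice M \<phi> + tensor_slice M \<psi>" for \<phi> \<psi>
    by (rule cdual_eqI) (simp add: cdual_apply_tensor_slice L.add M.add)
  have scaleC: "tensor_slice M (c *\<^sub>C \<phi>) = c *\<^sub>C tensor_slice M \<phi>" for c \<phi>
    using bounded_clinear_cdual_apply[of M]
      bounded_clinear_dual_left[of tensor_right, OF bounded_clinear_tensor_right[where 'a='a]]
    by (intro cdual_eqI) (simp add: cdual_apply_tensor_slice bounded_clinear_def)
  have scaleR: "tensor_slice M (r *\<^sub>R \<phi>) = r *\<^sub>R tensor_slice M \<phi>" for r \<phi>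
    using scaleC[of "complex_of_real r" \<phi>] by (simp add: scaleC_of_real)
  have "norm (tensor_slice M \<phi>) \<le> norm \<phi> * norm M" for \<phi>
  proof (rule norm_cdual_bound)
    fix x
    have "cmod (cdual_apply (tensor_slice M \<phi>) x) \<le> norm M * norm (tensor_dual_left x \<phi>)"
      by (simp add: cdual_apply_tensor_slice norm_cdual_apply)
    also have "\<dots> \<le> norm M * (norm x * norm \<phi>)"
      by (intro mult_left_mono norm_tensor_dual_left) simp
    finally show "cmod (cdual_apply (tensor_slice M \<phi>) x) \<le> norm \<phi> * norm M * norm x"
      by (simp add: mult_ac)
  qed simp
  then show ?thesis
    unfolding bounded_clinear_def
    by (intro conjI allI bounded_linear_intro[where K="norm M"] add scaleC scaleR)
qed

theorem proposition3p2:
  fixes \<sigma> :: "'a::{complex_normed_algebra, banach} \<Rightarrow> 'a"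
  assumes "\<sigma> \<in> Hom"
    and "\<exists>M. sigma_virtual_diagonal \<sigma> M"
  shows "sigma_biflat \<sigma>"
proof -
  obtain M where comm: "tensor_bidual_left (\<sigma> a) M = tensor_bidual_right M (\<sigma> a)"
    and diag: "alg_bidual_right (cadjoint (cadjoint diagonal_operator) M) (\<sigma> a)
      = cbidual_embed (\<sigma> a)" for a
    using assms(2) unfolding sigma_virtual_diagonal_def by blast
  have mult: "\<sigma> (a * b) = \<sigma> a * \<sigma> b" for a b
    using assms(1) by (simp add: Hom_def)
  note \<sigma> = bounded_clinear_Hom[OF assms(1)]
  define \<rho> where "\<rho> \<phi> = cadjoint \<sigma> (tensor_slice M \<phi>)" for \<phi>
  have left: "cdual_apply (\<rho> \<phi>) x = cdual_apply M (tensor_dual_left (\<sigma> x) \<phi>)" for \<phi> x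
    by (simp add: \<rho>_def cdual_apply_cadjoint[OF \<sigma>] cdual_apply_tensor_slice)
  have right: "cdual_apply (\<rho> \<phi>) x = cdual_apply M (tensor_dual_right \<phi> (\<sigma> x))" for \<phi> x
    using arg_cong[OF comm[of x], of "\<lambda>N. cdual_apply N \<phi>"]
    by (simp add: left cdual_apply_tensor_bidual_left cdual_apply_tensor_bidual_right)
  have "bounded_clinear \<rho>"
    unfolding \<rho>_def
    by (rule bounded_clinear_compose[OF bounded_clinear_cadjoint[OF \<sigma>] bounded_clinear_tensor_slice])
  moreover have "\<rho> (tensor_dual_left (\<sigma> a) \<phi>) = alg_dual_left a (\<rho> \<phi>)" for a \<phi>
    by (rule cdual_eqI) (simp add: left cdual_apply_alg_dual_left tensor_dual_left_left mult)
  moreover have "\<rho> (tensor_dual_right \<phi> (\<sigma> a)) = alg_dual_right (\<rho> \<phi>) a" for a \<phi>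
    by (rule cdual_eqI) (simp add: right cdual_apply_alg_dual_right tensor_dual_right_right mult)
  moreover have "\<rho> \<circ> cadjoint diagonal_operator = cadjoint \<sigma>"
  proof (rule ext, rule cdual_eqI)
    fix \<psi> x
    have "cdual_apply ((\<rho> \<circ> cadjoint diagonal_operator) \<psi>) x
        = cdual_apply M (cadjoint diagonal_operator (alg_dual_left (\<sigma> x) \<psi>))"
      by (simp add: left tensor_dual_left_cadjoint_diagonal)
    also have "\<dots> = cdual_apply
        (alg_bidual_right (cadjoint (cadjoint diagonal_operator) M) (\<sigma> x)) \<psi>"
      by (simp add: cdual_apply_alg_bidual_right
          cdual_apply_cadjoint[OF bounded_clinear_cadjoint[OF bounded_clinear_diagonal_operator]])
    also have "\<dots> = cdual_apply (cadjoint \<sigma> \<psi>) x"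
      by (simp add: diag cdual_apply_cbidual_embed cdual_apply_cadjoint[OF \<sigma>])
    finally show "cdual_apply ((\<rho> \<circ> cadjoint diagonal_operator) \<psi>) x
        = cdual_apply (cadjoint \<sigma> \<psi>) x" .
  qed
  ultimately show ?thesis
    unfolding sigma_biflat_def by blast
qed

end
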